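(* Let $m$ be a deficient number and let $p$ be a prime dividing $m$ with $p^\alpha\,\|\,m$. Then $mp$ is a primitive abundant number if and only if $p\,\sigma(p^\alpha) < c(m)$ and, for each prime power $q^\beta\,\|\,m$ with $q\neq p$, $$p\,\sigma(p^\alpha) > \frac{\sigma(m)}{d(m)+\frac{2m}{\sigma(q^\beta)-1}}.$$
   Context: For $n\in\mathbb{N}$, $\sigma(n)=\sum_{d\mid n}d$. $n$ is deficient if $\sigma(n)<2n$, perfect if $\sigma(n)=2n$, abundant if $\sigma(n)>2n$, and non-deficient if perfect or abundant. The deficiency is $d(n)=2n-\sigma(n)$ and the center is $c(n)=\sigma(n)/d(n)$. A number is primitive non-deficient if it is non-deficient and all its proper divisors are deficient. A primitive abundant number is a primitive non-deficient number that is abundant. $q^\beta\,\|\,m$ means $q^\beta\mid m$ and $q^{\beta+1}\nmid m$. *)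

theory Defs
  imports Complex_Main "HOL-Computational_Algebra.Primes"
begin

definition divisor_sigma :: "nat \<Rightarrow> nat" where
  "divisor_sigma n = (\<Sum>d | d dvd n. d)"

(* The set of divisors of 0 is infinite, so divisor_sigma 0 = 0 and 0 would satisfy
   divisor_sigma n = 2 * n; hence the positivity conditions below. *)

definition deficient :: "nat \<Rightarrow> bool" where
  "deficient n \<longleftrightarrow> n > 0 \<and> divisor_sigma n < 2 * n"

definition perfect :: "nat \<Rightarrow> bool" where
  "perfect n \<longleftrightarrow> n > 0 \<and> divisor_sigma n = 2 * n"

definition abundant :: "nat \<Rightarrow> bool" where
  "abundant n \<longleftrightarrow> n > 0 \<and> divisor_sigma n > 2 * n"

definition non_deficient :: "nat \<Rightarrow> bool" where
  "non_deficient n \<longleftrightarrow> perfect n \<or> abundant n"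

definition deficiency :: "nat \<Rightarrow> int" where
  "deficiency n = 2 * int n - int (divisor_sigma n)"

(* Used only where the deficiency is nonzero; real division makes it 0 at perfect numbers. *)
definition center :: "nat \<Rightarrow> real" where
  "center n = real (divisor_sigma n) / real_of_int (deficiency n)"

definition primitive_non_deficient :: "nat \<Rightarrow> bool" where
  "primitive_non_deficient n \<longleftrightarrow>
     non_deficient n \<and> (\<forall>k. k dvd n \<and> k \<noteq> n \<longrightarrow> deficient k)"

definition primitive_abundant :: "nat \<Rightarrow> bool" where
  "primitive_abundant n \<longleftrightarrow> primitive_non_deficient n \<and> abundant n"

definition exactly_divides :: "nat \<Rightarrow> nat \<Rightarrow> nat \<Rightarrow> bool" where
  "exactly_divides q b m \<longleftrightarrow> q ^ b dvd m \<and> \<not> q ^ (b + 1) dvd m"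

end

theory Submission
  imports Defs
begin

text \<open>
  Multiplying \<open>n\<close> by a prime \<open>p\<close> with \<open>p ^ a\<close> exactly dividing \<open>n\<close> replaces the factor
  \<open>s = \<sigma>(p ^ a)\<close> of \<open>\<sigma>(n)\<close> by \<open>p s + 1\<close>. Applied to \<open>m p\<close>, this turns abundance into
  the upper bound \<open>p s < c(m)\<close>. Since divisors of deficient numbers are deficient, primitivity only
  concerns the maximal proper divisors \<open>m\<close> and \<open>m p / q\<close> of \<open>m p\<close>; applied to
  \<open>m / q\<close> at both \<open>p\<close> and \<open>q\<close>, the same rule turns deficiency of \<open>m p / q\<close> into the lower bound for \<open>q\<close>.
\<close>

lemma exactly_dividesE:
  assumes "exactly_divides q b n"
  obtains u where "n = q ^ b * u" "\<not> q dvd u"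
proof -
  obtain u where u: "n = q ^ b * u"
    using assms unfolding exactly_divides_def by auto
  moreover have "\<not> q dvd u"
    using assms mult_dvd_mono[of "q ^ b" "q ^ b" q u] unfolding exactly_divides_def u
    by (auto simp: mult.commute)
  ultimately show thesis by (rule that)
qed

text \<open>Multiplication maps pairs of divisors of \<open>a\<close> and \<open>b\<close>
  bijectively onto divisors of \<open>a * b\<close>: coprimality makes the gcd of
  \<open>x * y\<close> with \<open>a\<close> recover \<open>x\<close>, and then \<open>y\<close>
  follows by cancellation.\<close>

lemma divisor_sigma_mult_coprime:
  assumes "coprime a b" "a > 0" "b > 0"
  shows "divisor_sigma (a * b) = divisor_sigma a * divisor_sigma b"
proof -
  let ?A = "{d. d dvd a}" and ?B = "{d. d dvd b}"
  have inj: "inj_on (\<lambda>(x, y). x * y) (?A \<times> ?B)"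
  proof (rule inj_onI, clarify)
    fix x y x' y'
    assume *: "x dvd a" "y dvd b" "x' dvd a" "y' dvd b" "x * y = x' * y'"
    have gcd_eq: "gcd (u * v) a = u" if "u dvd a" "v dvd b" for u v
    proof -
      have "coprime v a"
        using assms(1) that(2) by (meson coprime_commute coprime_divisors dvd_refl)
      then have "gcd (u * v) a = gcd u a"
        by (metis coprime_commute gcd.commute gcd_mult_right_right_cancel)
      then show ?thesis using that(1) by (simp add: gcd_proj1_iff)
    qed
    have "x = x'" using gcd_eq[of x y] gcd_eq[of x' y'] * by metis
    moreover have "x > 0" using *(1) assms(2) by (meson dvd_pos_nat)
    ultimately show "x = x' \<and> y = y'" using *(5) by simp
  qed
  have img: "(\<lambda>(x, y). x * y) ` (?A \<times> ?B) = {d. d dvd a * b}"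
    by (auto simp: image_iff mult_dvd_mono) (metis division_decomp)
  have "divisor_sigma a * divisor_sigma b = (\<Sum>(x, y)\<in>?A \<times> ?B. x * y)"
    by (simp add: divisor_sigma_def sum_product sum.cartesian_product)
  also have "\<dots> = divisor_sigma (a * b)"
    using sum.reindex[OF inj, of id] img
    by (simp add: divisor_sigma_def o_def case_prod_unfold)
  finally show ?thesis by simp
qed

text \<open>In 1 + p + ... + p^(k+1), every term after the first carries a factor
  \<open>p\<close>.\<close>

lemma divisor_sigma_prime_power_Suc:
  assumes "prime p"
  shows "divisor_sigma (p ^ Suc k) = p * divisor_sigma (p ^ k) + 1"
proof -
  have sigma: "divisor_sigma (p ^ j) = (\<Sum>i\<le>j. p ^ i)" for j
  proof -
    have "{d. d dvd p ^ j} = (\<lambda>i. p ^ i) ` {..j}"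
      using assms by (auto simp: divides_primepow_nat)
    moreover have "inj_on (\<lambda>i. p ^ i) {..j}"
      using assms prime_gt_1_nat by (auto intro!: inj_onI)
    ultimately show ?thesis by (simp add: divisor_sigma_def sum.reindex)
  qed
  show ?thesis
    unfolding sigma sum.atMost_Suc_shift by (simp add: sum_distrib_left)
qed

lemma divisor_sigma_pos:
  assumes "n > 0"
  shows "divisor_sigma n > 0"
  unfolding divisor_sigma_def using assms
  by (intro sum_pos2[of _ 1]) auto

text \<open>Only the \<open>p\<close>-part of \<open>n\<close> changes, by multiplicativity. The
  ratio is cross-multiplied so as to stay in the naturals. The case \<open>a = 0\<close> is
  included; it occurs below when a prime divides \<open>m\<close> exactly once and is then
  removed.\<close>

lemma divisor_sigma_mult_prime:
  assumes "prime p" "exactly_divides p a n"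
  shows "divisor_sigma (n * p) * divisor_sigma (p ^ a) =
    (p * divisor_sigma (p ^ a) + 1) * divisor_sigma n"
proof -
  obtain k where k: "n = p ^ a * k" and "\<not> p dvd k"
    using assms(2) by (rule exactly_dividesE)
  then have cop: "coprime (p ^ j) k" for j
    using assms(1) by (simp add: prime_imp_coprime)
  have pos: "p > 0" "k > 0"
    using assms(1) prime_gt_0_nat \<open>\<not> p dvd k\<close> by (auto intro: gr0I)
  have "divisor_sigma n = divisor_sigma (p ^ a) * divisor_sigma k"
    unfolding k using cop pos by (intro divisor_sigma_mult_coprime) auto
  moreover have "n * p = p ^ Suc a * k" using k by simp
  then have "divisor_sigma (n * p) = divisor_sigma (p ^ Suc a) * divisor_sigma k"
    using divisor_sigma_mult_coprime[OF cop, of "Suc a"] pos by (simp del: power_Suc)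
  ultimately show ?thesis
    by (simp add: divisor_sigma_prime_power_Suc[OF assms(1)] algebra_simps del: power_Suc)
qed

text \<open>Scaling by \<open>c\<close> embeds the divisors of \<open>n\<close> injectively into
  those of \<open>n * c\<close>.\<close>

lemma divisor_sigma_mult_ge:
  assumes "n * c > 0"
  shows "c * divisor_sigma n \<le> divisor_sigma (n * c)"
proof -
  have "c * divisor_sigma n = (\<Sum>d\<in>(\<lambda>d. d * c) ` {d. d dvd n}. d)"
    using assms
    by (subst sum.reindex) (auto simp: divisor_sigma_def sum_distrib_left mult.commute inj_on_def)
  also have "\<dots> \<le> divisor_sigma (n * c)"
    unfolding divisor_sigma_def using assms by (intro sum_mono2) auto
  finally show ?thesis .
qed

text \<open>The ratio of \<open>divisor_sigma n\<close> to \<open>n\<close> cannot decrease on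
  passing to a multiple.\<close>

lemma deficient_dvd:
  assumes "deficient n" "k dvd n"
  shows "deficient k"
proof -
  obtain c where c: "n = k * c" using assms(2) by auto
  have "c * divisor_sigma k \<le> divisor_sigma n"
    using divisor_sigma_mult_ge[of k c] assms(1) unfolding c deficient_def by simp
  also have "\<dots> < c * (2 * k)"
    using assms(1) by (simp add: deficient_def c mult_ac)
  finally show ?thesis using assms(1) by (auto simp: deficient_def c)
qed

text \<open>If \<open>n = k * c\<close> with \<open>c \<noteq> 1\<close>, any prime \<open>r\<close>
  dividing \<open>c\<close> gives \<open>k dvd n div r\<close>, and deficiency passes down to
  \<open>k\<close>.\<close>

lemma proper_divisors_deficient_iff:
  assumes "n > 0"
  shows "(\<forall>k. k dvd n \<and> k \<noteq> n \<longrightarrow> deficient k) \<longleftrightarrow> (\<forall>r. prime r \<and> r dvd n \<longrightarrow> deficient (n div r))"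
    (is "?L \<longleftrightarrow> ?R")
proof
  assume ?L
  moreover have "n div r dvd n" "n div r \<noteq> n" if "prime r" "r dvd n" for r
    using that assms prime_gt_1_nat[of r] by (auto simp: div_dvd_iff_mult)
  ultimately show ?R by blast
next
  assume R: ?R
  show ?L
  proof (intro allI impI)
    fix k assume k: "k dvd n \<and> k \<noteq> n"
    then obtain c where c: "n = k * c" by auto
    then have "c \<noteq> 1" using k by auto
    then obtain r where r: "prime r" "r dvd c" using prime_factor_nat by blast
    then obtain e where "c = r * e" by auto
    then have "n div r = k * e" using c r prime_gt_0_nat[of r] by simp
    moreover have "deficient (n div r)" using R r c by auto
    ultimately show "deficient k" by (auto intro: deficient_dvd)
  qed
qed

lemma abundant_mult_prime_iff:
  assumes "deficient m" "prime p" "exactly_divides p a m"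
  shows "abundant (m * p) \<longleftrightarrow> real (p * divisor_sigma (p ^ a)) < center m"
proof -
  define s where "s = divisor_sigma (p ^ a)"
  define S where "S = divisor_sigma m"
  have pos: "m > 0" "p > 0" "s > 0" and S: "S < 2 * m"
    using assms(1) prime_gt_0_nat[OF assms(2)]
    by (auto simp: deficient_def s_def S_def divisor_sigma_pos)
  have d: "real_of_int (deficiency m) = 2 * real m - real S" by (simp add: deficiency_def S_def)
  \<comment> \<open>The positive factor \<open>s\<close> is inserted so that the cross-multiplied
    rule for \<open>m * p\<close> can be substituted.\<close>
  have "abundant (m * p) \<longleftrightarrow> 2 * (m * p) * s < divisor_sigma (m * p) * s"
    using pos by (simp add: abundant_def)
  also have "\<dots> \<longleftrightarrow> 2 * (m * p) * s < (p * s + 1) * S"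
    using divisor_sigma_mult_prime[OF assms(2,3)] by (simp add: s_def S_def)
  also have "\<dots> \<longleftrightarrow> 2 * (real m * p) * s < (real p * s + 1) * S"
    by (subst of_nat_less_iff[symmetric, where ?'a = real]) (simp add: algebra_simps)
  also have "\<dots> \<longleftrightarrow> real p * s * (2 * real m - S) < S" by (simp add: algebra_simps)
  \<comment> \<open>Deficiency of \<open>m\<close> makes the divisor positive, so the direction of
    the inequality is kept.\<close>
  also have "\<dots> \<longleftrightarrow> real p * s < S / (2 * real m - S)" using S by (simp add: pos_less_divide_eq)
  finally show ?thesis by (simp add: center_def d s_def S_def)
qed

text \<open>Since \<open>b \<ge> 1\<close>, the recursion gives
  \<open>divisor_sigma (q ^ b) - 1 = q * t\<close> with \<open>t\<close> the divisor sum of the next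
  lower power of \<open>q\<close>; this positive product is the inner denominator. The criterion is
  first derived for \<open>n * p\<close> with \<open>n = m / q\<close>, then rewritten in terms of
  \<open>m\<close>.\<close>

lemma deficient_mult_prime_div_iff:
  assumes "deficient m" "prime p" "exactly_divides p a m"
    and "prime q" "q \<noteq> p" "exactly_divides q b m" "b \<ge> 1"
  shows "deficient (m * p div q) \<longleftrightarrow>
    real (divisor_sigma m) /
      (real_of_int (deficiency m) + 2 * real m / (real (divisor_sigma (q ^ b)) - 1))
    < real (p * divisor_sigma (p ^ a))"
proof -
  obtain c where c: "b = Suc c" using assms(7) by (cases b) auto
  obtain u where u: "m = q ^ b * u" "\<not> q dvd u"
    using assms(6) by (rule exactly_dividesE)
  define n where "n = q ^ c * u"
  have m: "m = n * q" by (simp add: u c n_def)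
  have qpos: "q > 0" and ppos: "p > 0"
    using assms(2,4) by (auto intro: prime_gt_0_nat)
  have npos: "n > 0" using assms(1) m by (auto simp: deficient_def)
  have ex_q: "exactly_divides q c n"
    using u(2) qpos by (auto simp: exactly_divides_def n_def)
  \<comment> \<open>Removing a factor \<open>q\<close> from \<open>m\<close> leaves the exponent of
    \<open>p\<close> unchanged.\<close>
  have "coprime (p ^ j) q" for j
    using assms(2,4,5) by (simp add: primes_coprime)
  then have ex_p: "exactly_divides p a n"
    using assms(3) unfolding exactly_divides_def m by (simp only: coprime_dvd_mult_left_iff) simp
  define s where "s = divisor_sigma (p ^ a)"
  define t where "t = divisor_sigma (q ^ c)"
  define S where "S = divisor_sigma m"
  define N where "N = divisor_sigma n"
  have pos: "s > 0" "t > 0" and S: "S < 2 * m"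
    using assms(1) ppos qpos by (auto simp: deficient_def s_def t_def S_def divisor_sigma_pos)
  have d: "real_of_int (deficiency m) = 2 * real m - real S" by (simp add: deficiency_def S_def)
  have t: "divisor_sigma (q ^ b) = q * t + 1"
    unfolding c t_def by (rule divisor_sigma_prime_power_Suc[OF assms(4)])
  have St: "S * t = (q * t + 1) * N"
    using divisor_sigma_mult_prime[OF assms(4) ex_q] by (simp add: S_def m t_def N_def)
  have "m * p div q = n * p" using m qpos by simp
  then have "deficient (m * p div q) \<longleftrightarrow> divisor_sigma (n * p) * s < 2 * (n * p) * s"
    using pos npos ppos by (simp add: deficient_def)
  also have "\<dots> \<longleftrightarrow> (p * s + 1) * N < 2 * (n * p) * s"
    using divisor_sigma_mult_prime[OF assms(2) ex_p] by (simp add: s_def N_def)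
  \<comment> \<open>This factor eliminates both quantities attached to \<open>n\<close>:
    \<open>(q * t + 1) * N\<close> becomes \<open>S * t\<close> on the left, and
    \<open>n * q\<close> becomes \<open>m\<close> on the right.\<close>
  also have "\<dots> \<longleftrightarrow> (p * s + 1) * N * (q * (q * t + 1)) < 2 * (n * p) * s * (q * (q * t + 1))"
    using qpos by simp
  also have "(p * s + 1) * N * (q * (q * t + 1)) = (p * s + 1) * S * (q * t)"
    using St by (metis mult.assoc mult.commute)
  also have "2 * (n * p) * s * (q * (q * t + 1)) = 2 * m * p * s * (q * t + 1)"
    by (simp add: m algebra_simps)
  also have "(p * s + 1) * S * (q * t) < 2 * m * p * s * (q * t + 1) \<longleftrightarrow>
      (real p * s + 1) * S * (q * t) < 2 * m * real p * s * (real q * t + 1)"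
    by (subst of_nat_less_iff[symmetric, where ?'a = real]) (simp add: algebra_simps)
  \<comment> \<open>The term \<open>p * s * S * q * t\<close> moves to the right, where it turns
    \<open>2 * m\<close> into the deficiency of \<open>m\<close>; dividing by \<open>q * t\<close>
    then yields the stated denominator.\<close>
  also have "\<dots> \<longleftrightarrow> real S * (q * t) < real p * s * ((2 * real m - S) * (q * t) + 2 * m)"
    by (simp add: algebra_simps)
  also have "\<dots> \<longleftrightarrow> real S < real p * s * ((2 * real m - S) + 2 * m / (real q * t))"
  proof -
    have "real (q * t) > 0" using pos qpos by simp
    have "real p * s * ((2 * real m - S) * (q * t) + 2 * m) =
        real p * s * ((2 * real m - S) + 2 * m / (real q * t)) * (q * t)"
      using pos qpos by (simp add: field_simps)
    then show ?thesis by (simp only: mult_less_cancel_right_pos[OF \<open>real (q * t) > 0\<close>])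
  qed
  also have "\<dots> \<longleftrightarrow> real S / ((2 * real m - S) + 2 * m / (real q * t)) < real p * s"
  proof -
    have "(2 * real m - S) + 2 * m / (real q * t) > 0"
      using S by (intro add_pos_nonneg) auto
    then show ?thesis by (simp add: pos_divide_less_eq)
  qed
  finally show ?thesis by (simp add: d t S_def s_def)
qed

lemma exactly_divides_exists:
  assumes "prime q" "q dvd m" "m > 0"
  obtains b where "b \<ge> 1" "exactly_divides q b m"
proof
  have fin: "\<not> is_unit q" "m \<noteq> 0" using assms prime_gt_1_nat[of q] by auto
  show "exactly_divides q (multiplicity q m) m"
    using fin by (auto simp: exactly_divides_def multiplicity_dvd power_dvd_iff_le_multiplicity
        simp del: power_Suc)
  show "multiplicity q m \<ge> 1"
    using assms by (simp add: prime_multiplicity_gt_zero_iff Suc_le_eq)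
qed

theorem theorem2p14:
  fixes m p \<alpha> :: nat
  assumes "deficient m"
    and "prime p"
    and "p dvd m"
    and "exactly_divides p \<alpha> m"
  shows "primitive_abundant (m * p) \<longleftrightarrow>
    real (p * divisor_sigma (p ^ \<alpha>)) < center m \<and>
    (\<forall>q \<beta> :: nat. prime q \<and> \<beta> \<ge> 1 \<and> exactly_divides q \<beta> m \<and> q \<noteq> p \<longrightarrow>
      real (p * divisor_sigma (p ^ \<alpha>)) >
        real (divisor_sigma m) /
          (real_of_int (deficiency m) + 2 * real m / (real (divisor_sigma (q ^ \<beta>)) - 1)))"
    (is "_ \<longleftrightarrow> ?upper \<and> ?lower")
proof -
  have pos: "m > 0" "p > 0"
    using assms(1,2) by (auto simp: deficient_def intro: prime_gt_0_nat)
  have "(\<forall>k. k dvd m * p \<and> k \<noteq> m * p \<longrightarrow> deficient k) \<longleftrightarrow>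
      (\<forall>r. prime r \<and> r dvd m * p \<longrightarrow> deficient (m * p div r))"
    using pos by (intro proper_divisors_deficient_iff) simp
  \<comment> \<open>The prime \<open>p\<close> contributes only \<open>m\<close>, which is deficient
    by assumption. As \<open>p dvd m\<close>, every prime dividing \<open>m * p\<close> already
    divides \<open>m\<close>.\<close>
  also have "\<dots> \<longleftrightarrow> (\<forall>q. prime q \<and> q dvd m \<and> q \<noteq> p \<longrightarrow> deficient (m * p div q))"
  proof -
    have "m * p div p = m" using pos by simp
    moreover have "r dvd m" if "prime r" "r dvd m * p" for r
      using that assms(2,3) by (metis prime_dvd_mult_iff primes_dvd_imp_eq)
    ultimately show ?thesis using assms(1) by (metis dvd_mult2)
  qed
  \<comment> \<open>The bound \<open>\<beta> \<ge> 1\<close> keeps exactly the primes dividing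
    \<open>m\<close>: exponent 0 would admit every prime not dividing \<open>m\<close>.\<close>
  also have "\<dots> \<longleftrightarrow> (\<forall>q \<beta>. prime q \<and> \<beta> \<ge> 1 \<and> exactly_divides q \<beta> m \<and> q \<noteq> p \<longrightarrow>
      deficient (m * p div q))"
  proof -
    have "q dvd m" if "exactly_divides q b m" "b \<ge> 1" for q b
      using that unfolding exactly_divides_def by (meson dvd_power dvd_trans less_le_trans zero_less_one)
    then show ?thesis using exactly_divides_exists pos(1) by metis
  qed
  also have "\<dots> \<longleftrightarrow> ?lower"
    using deficient_mult_prime_div_iff[OF assms(1,2,4)] by blast
  finally have "(\<forall>k. k dvd m * p \<and> k \<noteq> m * p \<longrightarrow> deficient k) \<longleftrightarrow> ?lower" .
  then show ?thesis
    using abundant_mult_prime_iff[OF assms(1,2,4)]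
    unfolding primitive_abundant_def primitive_non_deficient_def non_deficient_def by blast
qed

end
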